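(* Let $\mathcal{A}$ be a $C^*$-algebra with unit $e$ and let $H$ be a complex Hilbert space. If $\phi: \mathcal{A} \rightarrow B(H)$ is a unital $2$-positive linear map, then $$\|\phi(ab) - \phi(a)\phi(b)\| \le \left(\inf_{\lambda \in \mathbb{C}} \|a - \lambda e\|\right)\left(\inf_{\mu \in \mathbb{C}} \|b - \mu e\|\right)$$ for all $a, b \in \mathcal{A}$.
   Context: $B(H)$ is the $C^*$-algebra of bounded operators on $H$, with unit $1$ (the identity operator). A linear map $\phi:\mathcal{A}\to B(H)$ is unital if $\phi(e)=1$, and positive if $\phi(a)$ is positive in $B(H)$ for every positive $a\in\mathcal{A}$. $M_n(\mathcal{A})$ denotes the $C^*$-algebra of $n\times n$ matrices over $\mathcal{A}$, and $\phi_n : M_n(\mathcal{A}) \to M_n(B(H))$ is defined by $\phi_n((a_{ij})) = (\phi(a_{ij}))$. The map $\phi$ is $n$-positive if $\phi_n$ is a positive map. *)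

theory Defs
  imports "HOL-Analysis.Analysis" "Jordan_Normal_Form.Matrix"
begin

section \<open>Complex normed spaces and complex Hilbert spaces\<close>

class scaleC = scaleR +
  fixes scaleC :: "complex \<Rightarrow> 'a \<Rightarrow> 'a"  (infixr \<open>*\<^sub>C\<close> 75)
  assumes scaleR_scaleC: "r *\<^sub>R x = complex_of_real r *\<^sub>C x"

class complex_normed_vector = real_normed_vector + scaleC +
  assumes scaleC_add_right: "c *\<^sub>C (x + y) = c *\<^sub>C x + c *\<^sub>C y"
    and scaleC_add_left: "(c + d) *\<^sub>C x = c *\<^sub>C x + d *\<^sub>C x"
    and scaleC_scaleC: "c *\<^sub>C (d *\<^sub>C x) = (c * d) *\<^sub>C x"
    and scaleC_one: "1 *\<^sub>C x = x"
    and norm_scaleC: "norm (c *\<^sub>C x) = cmod c * norm x"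

text \<open>The inner product is linear in its first argument.  Positive definiteness is implied by
  \<open>cinner_self\<close> together with the norm axioms.\<close>

class complex_inner = complex_normed_vector +
  fixes cinner :: "'a \<Rightarrow> 'a \<Rightarrow> complex"
  assumes cinner_add_left: "cinner (x + y) z = cinner x z + cinner y z"
    and cinner_scaleC_left: "cinner (c *\<^sub>C x) y = c * cinner x y"
    and cinner_commute: "cinner y x = cnj (cinner x y)"
    and cinner_self: "cinner x x = complex_of_real ((norm x)\<^sup>2)"

class chilbert_space = complex_inner + complete_space

subclass (in chilbert_space) banach ..

definition clinear :: "('a::complex_normed_vector \<Rightarrow> 'b::complex_normed_vector) \<Rightarrow> bool" where
  "clinear f \<longleftrightarrow> (\<forall>x y. f (x + y) = f x + f y) \<and> (\<forall>c x. f (c *\<^sub>C x) = c *\<^sub>C f x)"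

section \<open>\<open>C\<^sup>*\<close>-algebras\<close>

class star =
  fixes star :: "'a \<Rightarrow> 'a"

class cstar_algebra = complex_normed_vector + real_normed_algebra + complete_space + star +
  assumes mult_scaleC_left: "(c *\<^sub>C x) * y = c *\<^sub>C (x * y)"
    and mult_scaleC_right: "x * (c *\<^sub>C y) = c *\<^sub>C (x * y)"
    and star_add: "star (x + y) = star x + star y"
    and star_scaleC: "star (c *\<^sub>C x) = cnj c *\<^sub>C star x"
    and star_mult: "star (x * y) = star y * star x"
    and star_star: "star (star x) = x"
    and cstar_identity: "norm (star x * x) = (norm x)\<^sup>2"

text \<open>The unit is not required to differ from zero, so the zero algebra is included
  (whence \<open>monoid_mult\<close> rather than \<open>ring_1\<close>).\<close>

class unital_cstar_algebra = cstar_algebra + monoid_mult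

section \<open>Basic facts on inner products and the Riesz representation\<close>

lemma scaleC_minus1: "(- 1) *\<^sub>C x = - (x :: 'a::complex_normed_vector)"
  using scaleR_scaleC[of "-1" x] by simp

lemma scaleC_minus_right: "c *\<^sub>C (- x) = - (c *\<^sub>C (x :: 'a::complex_normed_vector))"
  by (metis mult.commute scaleC_minus1 scaleC_scaleC)

lemma scaleC_diff_right: "c *\<^sub>C (x - y) = c *\<^sub>C x - c *\<^sub>C (y :: 'a::complex_normed_vector)"
  using scaleC_add_right[of c x "- y"] by (simp add: scaleC_minus_right)

lemma cinner_minus_left: "cinner (- x) y = - cinner x (y :: 'a::complex_inner)"
  using cinner_scaleC_left[of "-1" x y] by (simp add: scaleC_minus1)

lemma cinner_diff_left: "cinner (x - y) z = cinner x z - cinner y (z :: 'a::complex_inner)"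
  using cinner_add_left[of x "- y" z] by (simp add: cinner_minus_left)

lemma cinner_add_right: "cinner z (x + y) = cinner z x + cinner z (y :: 'a::complex_inner)"
  by (metis cinner_add_left cinner_commute complex_cnj_add)

lemma cinner_diff_right: "cinner z (x - y) = cinner z x - cinner z (y :: 'a::complex_inner)"
  by (metis cinner_diff_left cinner_commute complex_cnj_diff)

lemma cinner_scaleC_right: "cinner x (c *\<^sub>C y) = cnj c * cinner x (y :: 'a::complex_inner)"
  by (metis cinner_scaleC_left cinner_commute complex_cnj_mult)

lemma cinner_zero_left: "cinner 0 (y :: 'a::complex_inner) = 0"
  using cinner_diff_left[of y y y] by simp

lemma cinner_zero_right: "cinner (y :: 'a::complex_inner) 0 = 0"
  using cinner_diff_right[of y y y] by simp

lemma norm_eq_Re_cinner: "(norm x)\<^sup>2 = Re (cinner x (x :: 'a::complex_inner))"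
  by (simp add: cinner_self)

lemma cinner_eq_zero_iff: "cinner x x = 0 \<longleftrightarrow> x = (0 :: 'a::complex_inner)"
  by (simp add: cinner_self)

lemma cinner_eqI:
  fixes y z :: "'a::complex_inner"
  assumes "\<And>x. cinner x y = cinner x z"
  shows "y = z"
proof -
  have "cinner (y - z) (y - z) = 0"
    by (simp add: cinner_diff_right assms)
  then show ?thesis by (simp add: cinner_eq_zero_iff)
qed

lemma norm_diff_sq:
  fixes x y :: "'a::complex_inner"
  shows "(norm (x - c *\<^sub>C y))\<^sup>2
    = (norm x)\<^sup>2 - 2 * Re (cnj c * cinner x y) + (cmod c)\<^sup>2 * (norm y)\<^sup>2"
proof -
  have "cinner (x - c *\<^sub>C y) (x - c *\<^sub>C y)
    = cinner x x - cnj c * cinner x y - (cnj (cnj c * cinner x y) - c * cnj c * cinner y y)"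
    by (simp add: cinner_diff_left cinner_diff_right cinner_scaleC_left cinner_scaleC_right
        cinner_commute[of y x] algebra_simps)
  then have "Re (cinner (x - c *\<^sub>C y) (x - c *\<^sub>C y))
    = Re (cinner x x) - 2 * Re (cnj c * cinner x y) + Re (c * cnj c * cinner y y)"
    by simp
  also have "c * cnj c * cinner y y = complex_of_real ((cmod c)\<^sup>2 * (norm y)\<^sup>2)"
    by (simp add: cinner_self complex_mult_cnj cmod_power2 del: of_real_add)
  finally show ?thesis
    by (simp only: norm_eq_Re_cinner Re_complex_of_real)
qed

lemma parallelogram:
  fixes x y :: "'a::complex_inner"
  shows "(norm (x + y))\<^sup>2 + (norm (x - y))\<^sup>2 = 2 * (norm x)\<^sup>2 + 2 * (norm y)\<^sup>2"
  using norm_diff_sq[of x 1 y] norm_diff_sq[of x "-1" y] by (simp add: scaleC_one scaleC_minus1)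

lemma norm_cinner_le: "cmod (cinner x y) \<le> norm x * norm (y :: 'a::complex_inner)"
proof (cases "y = 0")
  case True
  then show ?thesis by (simp add: cinner_zero_right)
next
  case False
  define w where "w = cinner x y"
  define n where "n = (norm y)\<^sup>2"
  have n: "n > 0" using False by (simp add: n_def)
  have "0 \<le> (norm (x - (w / of_real n) *\<^sub>C y))\<^sup>2" by simp
  also have "\<dots> = (norm x)\<^sup>2 - 2 * Re (cnj (w / of_real n) * w) + (cmod (w / of_real n))\<^sup>2 * n"
    by (simp add: norm_diff_sq w_def n_def)
  also have "cnj (w / of_real n) * w = of_real ((cmod w)\<^sup>2 / n)"
    using complex_norm_square[of w] by (simp add: mult.commute)
  also have "(cmod (w / of_real n))\<^sup>2 * n = (cmod w)\<^sup>2 / n"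
    using n by (simp add: norm_divide power_divide power2_eq_square)
  finally have "(cmod w)\<^sup>2 \<le> (norm x)\<^sup>2 * n"
    using n by (simp add: field_simps)
  then have "(cmod w)\<^sup>2 \<le> (norm x * norm y)\<^sup>2"
    by (simp add: n_def power_mult_distrib)
  then show ?thesis
    unfolding w_def by (rule power2_le_imp_le) simp
qed

lemma riesz_representation:
  fixes f :: "'a::chilbert_space \<Rightarrow> complex"
  assumes bl: "bounded_linear f" and hom: "\<And>c x. f (c *\<^sub>C x) = c * f x"
  shows "\<exists>z. \<forall>x. f x = cinner x z"
proof (cases "\<forall>x. f x = 0")
  case True
  then show ?thesis by (intro exI[of _ 0]) (simp add: cinner_zero_right)
next
  case False
  interpret f: bounded_linear f by fact
  define S where "S = {x. f x = 1}"
  obtain x0 where x0: "f x0 \<noteq> 0" using False by blast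
  have "(1 / f x0) *\<^sub>C x0 \<in> S" using x0 by (simp add: S_def hom)
  then have Sne: "S \<noteq> {}" by blast
  define d where "d = (INF x\<in>S. (norm x)\<^sup>2)"
  have bdd: "bdd_below ((\<lambda>x. (norm x)\<^sup>2) ` S)" by (rule bdd_belowI2[of _ 0]) simp
  have dle: "d \<le> (norm x)\<^sup>2" if "x \<in> S" for x
    unfolding d_def by (rule cINF_lower[OF bdd that])
  have "\<exists>x. x \<in> S \<and> (norm x)\<^sup>2 < d + 1 / real (Suc n)" for n
  proof (rule ccontr)
    assume "\<nexists>x. x \<in> S \<and> (norm x)\<^sup>2 < d + 1 / real (Suc n)"
    then have "d + 1 / real (Suc n) \<le> d"
      unfolding d_def by (intro cINF_greatest Sne) (auto simp: not_less d_def)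
    then show False by simp
  qed
  then obtain u where uS: "\<And>n. u n \<in> S" and ud: "\<And>n. (norm (u n))\<^sup>2 < d + 1 / real (Suc n)"
    by metis
  have est: "(norm (u m - u n))\<^sup>2 \<le> 2 / real (Suc m) + 2 / real (Suc n)" for m n
  proof -
    have "(1/2) *\<^sub>R (u m + u n) \<in> S"
      using uS[of m] uS[of n] by (simp add: S_def f.scaleR f.add scaleR_conv_of_real)
    from dle[OF this] have "4 * d \<le> (norm (u m + u n))\<^sup>2"
      by (simp add: power_divide)
    moreover note parallelogram[of "u m" "u n"] ud[of m] ud[of n]
    ultimately show ?thesis by simp
  qed
  have "Cauchy u"
  proof (rule metric_CauchyI)
    fix e :: real assume e: "0 < e"
    obtain N where N: "real N > 4 / e\<^sup>2" using reals_Archimedean2 by blast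
    have small: "2 / real (Suc m) < e\<^sup>2 / 2" if "m \<ge> N" for m
    proof -
      have "4 / e\<^sup>2 < real (Suc m)" using N that by simp
      then show ?thesis using e by (simp add: field_simps)
    qed
    show "\<exists>M. \<forall>m\<ge>M. \<forall>n\<ge>M. dist (u m) (u n) < e"
    proof (intro exI[of _ N] allI impI)
      fix m n assume "N \<le> m" "N \<le> n"
      then have "(norm (u m - u n))\<^sup>2 < e\<^sup>2" using est[of m n] small[of m] small[of n] by simp
      then show "dist (u m) (u n) < e"
        using e by (simp add: dist_norm power2_less_imp_less)
    qed
  qed
  then obtain v where v: "u \<longlonglongrightarrow> v" using Cauchy_convergent convergent_def by blast
  have "(\<lambda>n. f (u n)) \<longlonglongrightarrow> f v" by (rule f.tendsto[OF v])
  moreover have "(\<lambda>n. f (u n)) = (\<lambda>n. 1)" using uS by (auto simp: S_def)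
  ultimately have fv: "f v = 1" by (simp add: LIMSEQ_const_iff)
  have "(\<lambda>n. (norm (u n))\<^sup>2) \<longlonglongrightarrow> (norm v)\<^sup>2" by (intro tendsto_intros v)
  moreover have "(\<lambda>n. d + 1 / real (Suc n)) \<longlonglongrightarrow> d + 0"
    using LIMSEQ_Suc[OF lim_1_over_n] by (intro tendsto_intros) simp
  ultimately have vd: "(norm v)\<^sup>2 \<le> d"
    using LIMSEQ_le[of "\<lambda>n. (norm (u n))\<^sup>2" "(norm v)\<^sup>2" "\<lambda>n. d + 1 / real (Suc n)" "d + 0"]
      less_imp_le[OF ud] by simp
  have v0: "norm v > 0" using fv f.zero by force
  have orth: "cinner v w = 0" if w: "f w = 0" for w
  proof (cases "w = 0")
    case True then show ?thesis by (simp add: cinner_zero_right)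
  next
    case False
    define n where "n = (norm w)\<^sup>2"
    have n: "n > 0" using False by (simp add: n_def)
    define c where "c = cinner v w / of_real n"
    have "v - c *\<^sub>C w \<in> S" using fv w by (simp add: S_def f.diff hom)
    from order_trans[OF vd dle[OF this]]
    have "(norm v)\<^sup>2 \<le> (norm (v - c *\<^sub>C w))\<^sup>2" .
    also have "\<dots> = (norm v)\<^sup>2 - 2 * Re (cnj c * cinner v w) + (cmod c)\<^sup>2 * n"
      by (simp add: norm_diff_sq n_def)
    also have "cnj c * cinner v w = of_real ((cmod (cinner v w))\<^sup>2 / n)"
      using complex_norm_square[of "cinner v w"] by (simp add: c_def mult.commute)
    also have "(cmod c)\<^sup>2 * n = (cmod (cinner v w))\<^sup>2 / n"
      using n by (simp add: c_def norm_divide power_divide power2_eq_square)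
    finally have "(cmod (cinner v w))\<^sup>2 / n \<le> 0" by simp
    then show ?thesis using n by (simp add: divide_le_0_iff)
  qed
  define z where "z = complex_of_real (1 / (norm v)\<^sup>2) *\<^sub>C v"
  have "f x = cinner x z" for x
  proof -
    have "f (x - f x *\<^sub>C v) = 0" by (simp add: f.diff hom fv)
    then have "cinner v (x - f x *\<^sub>C v) = 0" by (rule orth)
    then have "cinner (x - f x *\<^sub>C v) v = 0"
      using cinner_commute[of "x - f x *\<^sub>C v" v] by simp
    then have "cinner x v = f x * of_real ((norm v)\<^sup>2)"
      by (simp add: cinner_diff_left cinner_scaleC_left cinner_self)
    then show ?thesis using v0 by (simp add: z_def cinner_scaleC_right)
  qed
  then show ?thesis by blast
qed

section \<open>The \<open>C\<^sup>*\<close>-algebra of bounded operators on a complex Hilbert space\<close>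

text \<open>Complex-linear bounded operators form a subset of the real-linear ones;
  the (real) operator norm of the latter is the usual operator norm.\<close>

typedef (overloaded) 'h bop = "{T :: 'h::chilbert_space \<Rightarrow>\<^sub>L 'h. \<forall>c x. T (c *\<^sub>C x) = c *\<^sub>C T x}"
  morphisms blinfun_of_bop bop_of_blinfun
  by (rule exI[of _ 0]) (simp add: scaleC_diff_right[of _ 0 0, simplified])

setup_lifting type_definition_bop

definition bop_apply :: "'h::chilbert_space bop \<Rightarrow> 'h \<Rightarrow> 'h" where
  "bop_apply T x = blinfun_apply (blinfun_of_bop T) x"

lemma bop_eqI: "(\<And>x. bop_apply S x = bop_apply T x) \<Longrightarrow> S = T"
  unfolding bop_apply_def by (metis blinfun_eqI blinfun_of_bop_inject)

lemma bop_apply_scaleC: "bop_apply T (c *\<^sub>C x) = c *\<^sub>C bop_apply T x"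
  unfolding bop_apply_def using blinfun_of_bop[of T] by simp

lemma bop_apply_add: "bop_apply T (x + y) = bop_apply T x + bop_apply T y"
  unfolding bop_apply_def by (rule blinfun.add_right)

lemma bounded_linear_bop_apply: "bounded_linear (bop_apply T)"
  unfolding bop_apply_def by (simp add: blinfun.bounded_linear_right)

lemma bop_of_fun:
  assumes "bounded_linear f" and "\<And>c x. f (c *\<^sub>C x) = c *\<^sub>C f x"
  shows "bop_apply (bop_of_blinfun (Blinfun f)) = f"
proof -
  have "Blinfun f \<in> {T. \<forall>c x. blinfun_apply T (c *\<^sub>C x) = c *\<^sub>C blinfun_apply T x}"
    using assms by (simp add: bounded_linear_Blinfun_apply)
  then have "blinfun_of_bop (bop_of_blinfun (Blinfun f)) = Blinfun f"
    by (rule bop_of_blinfun_inverse)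
  then show ?thesis
    unfolding bop_apply_def by (simp add: bounded_linear_Blinfun_apply[OF assms(1)])
qed

instantiation bop :: (chilbert_space) real_normed_vector
begin

lift_definition zero_bop :: "'a bop" is 0
  by (simp add: scaleC_diff_right[of _ 0 0, simplified])

lift_definition plus_bop :: "'a bop \<Rightarrow> 'a bop \<Rightarrow> 'a bop" is "(+)"
  by (simp add: blinfun.add_left scaleC_add_right)

lift_definition uminus_bop :: "'a bop \<Rightarrow> 'a bop" is uminus
  by (simp add: blinfun.minus_left scaleC_minus_right)

lift_definition minus_bop :: "'a bop \<Rightarrow> 'a bop \<Rightarrow> 'a bop" is "(-)"
  by (simp add: blinfun.diff_left scaleC_diff_right)

lift_definition scaleR_bop :: "real \<Rightarrow> 'a bop \<Rightarrow> 'a bop" is scaleR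
  by (simp add: blinfun.scaleR_left scaleR_scaleC scaleC_scaleC mult.commute)

lift_definition norm_bop :: "'a bop \<Rightarrow> real" is norm .

definition dist_bop :: "'a bop \<Rightarrow> 'a bop \<Rightarrow> real" where
  "dist_bop S T = norm (S - T)"

definition sgn_bop :: "'a bop \<Rightarrow> 'a bop" where
  "sgn_bop T = scaleR (inverse (norm T)) T"

definition [code del]:
  "(uniformity :: ('a bop \<times> 'a bop) filter) = (INF e\<in>{0<..}. principal {(x, y). dist x y < e})"

definition open_bop :: "'a bop set \<Rightarrow> bool" where
  [code del]: "open_bop S = (\<forall>x\<in>S. \<forall>\<^sub>F (x', y) in uniformity. x' = x \<longrightarrow> y \<in> S)"

instance
proof
  fix S T U :: "'a bop" and a b :: real
  show "S + T + U = S + (T + U)" "S + T = T + S" "0 + S = S" "- S + S = 0" "S - T = S + - T"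
    by (transfer, simp)+
  show "a *\<^sub>R (S + T) = a *\<^sub>R S + a *\<^sub>R T" "(a + b) *\<^sub>R S = a *\<^sub>R S + b *\<^sub>R S"
    "a *\<^sub>R b *\<^sub>R S = (a * b) *\<^sub>R S" "1 *\<^sub>R S = S"
    by (transfer, simp add: algebra_simps)+
  show "dist S T = norm (S - T)" by (rule dist_bop_def)
  show "sgn S = inverse (norm S) *\<^sub>R S" by (rule sgn_bop_def)
  show "(norm S = 0) = (S = 0)" by transfer simp
  show "norm (S + T) \<le> norm S + norm T" by transfer (rule norm_triangle_ineq)
  show "norm (a *\<^sub>R S) = \<bar>a\<bar> * norm S" by transfer simp
qed (simp_all add: uniformity_bop_def open_bop_def)

end

lemma bop_apply_plus: "bop_apply (S + T) x = bop_apply S x + bop_apply T x"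
  by (simp add: bop_apply_def plus_bop.rep_eq blinfun.add_left)

lemma bop_apply_scaleR: "bop_apply (r *\<^sub>R T) x = r *\<^sub>R bop_apply T x"
  by (simp add: bop_apply_def scaleR_bop.rep_eq blinfun.scaleR_left)

lemma norm_bop_apply: "norm (bop_apply T x) \<le> norm T * norm x"
  unfolding bop_apply_def norm_bop.rep_eq by (rule norm_blinfun)

lemma norm_bop_bound: "0 \<le> b \<Longrightarrow> (\<And>x. norm (bop_apply T x) \<le> b * norm x) \<Longrightarrow> norm T \<le> b"
  unfolding bop_apply_def norm_bop.rep_eq by (rule norm_blinfun_bound)

instance bop :: (chilbert_space) banach
proof
  fix X :: "nat \<Rightarrow> 'a bop"
  assume X: "Cauchy X"
  have "Cauchy (\<lambda>n. blinfun_of_bop (X n))"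
    using X unfolding Cauchy_def dist_norm by (simp add: norm_bop.rep_eq minus_bop.rep_eq)
  then obtain L where L: "(\<lambda>n. blinfun_of_bop (X n)) \<longlonglongrightarrow> L"
    using Cauchy_convergent convergent_def by blast
  have bl: "bounded_linear (\<lambda>x::'a. c *\<^sub>C x)" for c
    by (rule bounded_linear_intro[of _ "cmod c"])
      (simp_all add: scaleC_add_right scaleR_scaleC scaleC_scaleC norm_scaleC mult.commute)
  have "blinfun_apply L (c *\<^sub>C x) = c *\<^sub>C blinfun_apply L x" for c x
  proof (rule LIMSEQ_unique)
    show "(\<lambda>n. blinfun_apply (blinfun_of_bop (X n)) (c *\<^sub>C x)) \<longlonglongrightarrow> blinfun_apply L (c *\<^sub>C x)"
      by (intro tendsto_intros L)
    have "(\<lambda>n. c *\<^sub>C blinfun_apply (blinfun_of_bop (X n)) x) \<longlonglongrightarrow> c *\<^sub>C blinfun_apply L x"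
      by (intro bounded_linear.tendsto[OF bl] tendsto_intros L)
    then show "(\<lambda>n. blinfun_apply (blinfun_of_bop (X n)) (c *\<^sub>C x)) \<longlonglongrightarrow> c *\<^sub>C blinfun_apply L x"
      by (simp add: bop_apply_scaleC[unfolded bop_apply_def])
  qed
  then obtain T where T: "blinfun_of_bop T = L"
    using bop_of_blinfun_inverse[of L] by blast
  have "X \<longlonglongrightarrow> T"
    using L unfolding LIMSEQ_def dist_norm by (simp add: norm_bop.rep_eq minus_bop.rep_eq T)
  then show "convergent X" by (auto simp: convergent_def)
qed

instantiation bop :: (chilbert_space) unital_cstar_algebra
begin

definition scaleC_bop :: "complex \<Rightarrow> 'a bop \<Rightarrow> 'a bop" where
  "c *\<^sub>C T = bop_of_blinfun (Blinfun (\<lambda>x. c *\<^sub>C bop_apply T x))"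

definition times_bop :: "'a bop \<Rightarrow> 'a bop \<Rightarrow> 'a bop" where
  "S * T = bop_of_blinfun (Blinfun (\<lambda>x. bop_apply S (bop_apply T x)))"

definition one_bop :: "'a bop" where
  "1 = bop_of_blinfun (Blinfun (\<lambda>x. x))"

text \<open>The Hilbert space adjoint.\<close>

definition star_bop :: "'a bop \<Rightarrow> 'a bop" where
  "star T = (THE S. \<forall>x y. cinner (bop_apply T x) y = cinner x (bop_apply S y))"

lemma bop_apply_scaleC_left: "bop_apply (c *\<^sub>C T) x = c *\<^sub>C bop_apply T x"
proof -
  have "bounded_linear (\<lambda>x. c *\<^sub>C bop_apply T x)"
  proof (rule bounded_linear_intro[of _ "cmod c * norm T"])
    show "norm (c *\<^sub>C bop_apply T x) \<le> norm x * (cmod c * norm T)" for x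
      using mult_left_mono[OF norm_bop_apply[of T x], of "cmod c"]
      by (simp add: norm_scaleC algebra_simps)
  qed (simp_all add: bop_apply_add scaleC_add_right scaleR_scaleC bop_apply_scaleC scaleC_scaleC
      mult.commute)
  then show ?thesis
    unfolding scaleC_bop_def
    by (subst bop_of_fun) (simp_all add: bop_apply_scaleC scaleC_scaleC mult.commute)
qed

lemma bop_apply_times: "bop_apply (S * T) x = bop_apply S (bop_apply T x)"
  unfolding times_bop_def
  by (subst bop_of_fun)
    (auto simp: bop_apply_scaleC intro: bounded_linear_compose bounded_linear_bop_apply)

lemma bop_apply_one: "bop_apply 1 x = x"
  unfolding one_bop_def by (subst bop_of_fun) auto

lemma adjoint_exists:
  "\<exists>S. \<forall>x y. cinner (bop_apply T x) y = cinner x (bop_apply S (y :: 'a))"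
proof -
  have "\<exists>z. \<forall>x. cinner (bop_apply T x) y = cinner x z" for y
  proof (rule riesz_representation)
    show "bounded_linear (\<lambda>x. cinner (bop_apply T x) y)"
    proof (rule bounded_linear_intro[of _ "norm T * norm y"])
      show "norm (cinner (bop_apply T x) y) \<le> norm x * (norm T * norm y)" for x
        using order_trans[OF norm_cinner_le[of "bop_apply T x" y]
            mult_right_mono[OF norm_bop_apply[of T x], of "norm y"]]
        by (simp add: algebra_simps)
    qed (simp_all add: bop_apply_add cinner_add_left scaleR_scaleC bop_apply_scaleC
        cinner_scaleC_left scaleR_conv_of_real)
  qed (simp add: bop_apply_scaleC cinner_scaleC_left)
  then obtain g where g: "\<And>x y. cinner (bop_apply T x) y = cinner x (g y)" by metis
  have gadd: "g (x + y) = g x + g y" for x y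
    by (rule cinner_eqI) (simp add: g[symmetric] cinner_add_right)
  have gsc: "g (c *\<^sub>C x) = c *\<^sub>C g x" for c x
    by (rule cinner_eqI) (simp add: g[symmetric] cinner_scaleC_right)
  have gn: "norm (g y) \<le> norm y * norm T" for y
  proof (cases "norm (g y) = 0")
    case False
    have "(norm (g y))\<^sup>2 = cmod (cinner (bop_apply T (g y)) y)"
      by (simp add: g cinner_self norm_power)
    also have "\<dots> \<le> norm (bop_apply T (g y)) * norm y" by (rule norm_cinner_le)
    also have "\<dots> \<le> norm T * norm (g y) * norm y"
      by (intro mult_right_mono norm_bop_apply) simp
    finally have "norm (g y) * norm (g y) \<le> norm (g y) * (norm y * norm T)"
      by (simp add: power2_eq_square algebra_simps)
    then show ?thesis using False by simp
  qed simp
  have "bounded_linear g"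
    by (rule bounded_linear_intro[of _ "norm T"]) (simp_all add: gadd scaleR_scaleC gsc gn)
  then have "bop_apply (bop_of_blinfun (Blinfun g)) = g" by (rule bop_of_fun) (rule gsc)
  then show ?thesis using g by (intro exI[of _ "bop_of_blinfun (Blinfun g)"]) simp
qed

lemma cinner_star: "cinner (bop_apply T x) y = cinner x (bop_apply (star T) (y :: 'a))"
proof -
  have "\<exists>!S. \<forall>x y. cinner (bop_apply T x) y = cinner x (bop_apply S y)"
    using adjoint_exists[of T] by (metis bop_eqI cinner_eqI)
  from theI'[OF this] show ?thesis unfolding star_bop_def by blast
qed

lemma cinner_star': "cinner (bop_apply (star T) x) y = cinner x (bop_apply T (y :: 'a))"
  by (metis cinner_commute cinner_star)

lemma norm_times_bop: "norm (S * T) \<le> norm S * norm (T :: 'a bop)"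
proof (rule norm_bop_bound)
  show "norm (bop_apply (S * T) x) \<le> norm S * norm T * norm x" for x
    using order_trans[OF norm_bop_apply[of S "bop_apply T x"]
        mult_left_mono[OF norm_bop_apply[of T x], of "norm S"]]
    by (simp add: bop_apply_times algebra_simps)
qed simp

lemma norm_sq_le_star_times: "(norm T)\<^sup>2 \<le> norm (star T * (T :: 'a bop))"
proof -
  have "norm T \<le> sqrt (norm (star T * T))"
  proof (rule norm_bop_bound)
    fix x
    have "(norm (bop_apply T x))\<^sup>2 = cmod (cinner (bop_apply T x) (bop_apply T x))"
      by (simp add: cinner_self norm_power)
    also have "\<dots> = cmod (cinner x (bop_apply (star T * T) x))"
      by (simp add: cinner_star bop_apply_times)
    also have "\<dots> \<le> norm x * norm (bop_apply (star T * T) x)" by (rule norm_cinner_le)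
    also have "\<dots> \<le> norm x * (norm (star T * T) * norm x)"
      by (intro mult_left_mono norm_bop_apply) simp
    also have "\<dots> = (sqrt (norm (star T * T)) * norm x)\<^sup>2"
      by (simp add: power_mult_distrib) (simp add: power2_eq_square)
    finally show "norm (bop_apply T x) \<le> sqrt (norm (star T * T)) * norm x"
      by (rule power2_le_imp_le) simp
  qed simp
  then show ?thesis
    by (metis norm_ge_zero power_mono real_sqrt_pow2)
qed

lemma star_star_bop: "star (star T) = (T :: 'a bop)"
  by (intro bop_eqI cinner_eqI) (simp add: cinner_star[symmetric] cinner_star')

lemma norm_star_le: "norm (star T) \<le> norm (T :: 'a bop)"
proof (cases "norm (star T) = 0")
  case False
  have "norm (star T) * norm (star T) \<le> norm (star T) * norm T"
    using norm_sq_le_star_times[of "star T"] norm_times_bop[of T "star T"]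
    by (simp add: star_star_bop power2_eq_square mult.commute)
  then show ?thesis using False by simp
qed simp

instance
proof
  fix S T U :: "'a bop" and c d :: complex and r :: real
  note app = bop_apply_plus bop_apply_scaleR bop_apply_scaleC_left bop_apply_times bop_apply_one
    bop_apply_add bop_apply_scaleC scaleC_scaleC scaleR_scaleC scaleC_add_right
    scaleC_add_left scaleC_one
  show "r *\<^sub>R S = complex_of_real r *\<^sub>C S"
    "c *\<^sub>C (S + T) = c *\<^sub>C S + c *\<^sub>C T" "(c + d) *\<^sub>C S = c *\<^sub>C S + d *\<^sub>C S"
    "c *\<^sub>C d *\<^sub>C S = (c * d) *\<^sub>C S" "1 *\<^sub>C S = S"
    "S * T * U = S * (T * U)" "(S + T) * U = S * U + T * U" "S * (T + U) = S * T + S * U"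
    "r *\<^sub>R S * T = r *\<^sub>R (S * T)" "S * r *\<^sub>R T = r *\<^sub>R (S * T)"
    "c *\<^sub>C S * T = c *\<^sub>C (S * T)" "S * c *\<^sub>C T = c *\<^sub>C (S * T)"
    "1 * S = S" "S * 1 = S"
    by (rule bop_eqI, simp add: app)+
  show "star (S + T) = star S + star T" "star (c *\<^sub>C S) = cnj c *\<^sub>C star S"
    "star (S * T) = star T * star S"
    by (intro bop_eqI cinner_eqI; simp add: app cinner_star[symmetric] cinner_add_left
        cinner_add_right cinner_scaleC_left cinner_scaleC_right)+
  show "star (star S) = S" by (rule star_star_bop)
  show "norm (S * T) \<le> norm S * norm T" by (rule norm_times_bop)
  show "norm (star S * S) = (norm S)\<^sup>2"
    using norm_sq_le_star_times[of S] norm_times_bop[of "star S" S]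
      mult_right_mono[OF norm_star_le[of S], of "norm S"]
    by (simp add: power2_eq_square)
  have le: "norm (c *\<^sub>C S) \<le> cmod c * norm S" for c and S :: "'a bop"
  proof (rule norm_bop_bound)
    show "norm (bop_apply (c *\<^sub>C S) x) \<le> cmod c * norm S * norm x" for x
      using mult_left_mono[OF norm_bop_apply[of S x], of "cmod c"]
      by (simp add: app norm_scaleC algebra_simps)
  qed simp
  show "norm (c *\<^sub>C S) = cmod c * norm S"
  proof (cases "c = 0")
    case True
    then show ?thesis using le[of 0 S] by simp
  next
    case False
    have "S = inverse c *\<^sub>C c *\<^sub>C S" by (rule bop_eqI) (simp add: app False)
    then have "norm S \<le> cmod (inverse c) * norm (c *\<^sub>C S)" using le by metis
    then have "cmod c * norm S \<le> norm (c *\<^sub>C S)"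
      using False by (simp add: norm_divide divide_simps mult.commute)
    then show ?thesis using le[of c S] by simp
  qed
qed

end

section \<open>Matrices over a \<open>C\<^sup>*\<close>-algebra and \<open>n\<close>-positive maps\<close>

definition star_mat :: "'a::star mat \<Rightarrow> 'a mat" where
  "star_mat A = transpose_mat (map_mat star A)"

text \<open>Positive elements of the \<open>C\<^sup>*\<close>-algebra of \<open>n \<times> n\<close> matrices, i.e. those of the form
  \<open>x\<^sup>* x\<close>.  This involves only the \<open>*\<close>-algebra structure, so the \<open>C\<^sup>*\<close>-norm on
  matrices is not needed.\<close>

definition positive_mat :: "nat \<Rightarrow> 'a::cstar_algebra mat \<Rightarrow> bool" where
  "positive_mat n A \<longleftrightarrow> (\<exists>X \<in> carrier_mat n n. A = star_mat X * X)"

definition n_positive :: "nat \<Rightarrow> ('a::cstar_algebra \<Rightarrow> 'b::cstar_algebra) \<Rightarrow> bool" where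
  "n_positive n \<phi> \<longleftrightarrow>
     (\<forall>A \<in> carrier_mat n n. positive_mat n A \<longrightarrow> positive_mat n (map_mat \<phi> A))"

end

theory Submission
  imports Defs
begin

text \<open>Both sides are invariant under \<open>a \<mapsto> a - \<lambda> e\<close>, \<open>b \<mapsto> b - \<mu> e\<close>, so by homogeneity it suffices to show
  \<open>\<parallel>\<phi>(ab) - \<phi>(a) \<phi>(b)\<parallel> \<le> 1\<close> when \<open>\<parallel>a\<parallel>, \<parallel>b\<parallel> < 1\<close>.  The matrix \<open>N\<close> with rows \<open>(0, a)\<close>, \<open>(b, 0)\<close> is then a
  contraction, and \<open>N\<^sup>2\<close> has the diagonal entries \<open>ab\<close>, \<open>ba\<close>.  Positivity of the single map \<open>\<phi>\<^sub>2\<close> on the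
  Fejer means of \<open>z N\<close>, \<open>\<bar>z\<bar> = 1\<close>, already makes the \<open>3 \<times> 3\<close> Toeplitz matrix of
  \<open>1, \<phi>\<^sub>2(N), \<phi>\<^sub>2(N\<^sup>2)\<close> positive, hence \<open>\<parallel>\<phi>\<^sub>2(N\<^sup>2) - \<phi>\<^sub>2(N)\<^sup>2\<parallel> \<le> 1\<close>, whose upper left corner is the claim.\<close>

section \<open>C*-algebra preliminaries\<close>

lemma star_zero: "star (0::'a::cstar_algebra) = 0"
  using star_add[of "0::'a" 0] by simp

lemma star_minus: "star (- x) = - star (x::'a::cstar_algebra)"
  using star_add[of x "- x"] by (simp add: star_zero eq_neg_iff_add_eq_0 add.commute)

lemma star_diff: "star (x - y) = star x - star (y::'a::cstar_algebra)"
  using star_add[of x "- y"] by (simp add: star_minus)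

lemma star_scaleR: "star (r *\<^sub>R x) = r *\<^sub>R star (x::'a::cstar_algebra)"
  by (simp add: scaleR_scaleC star_scaleC)

lemma star_one: "star (1::'a::unital_cstar_algebra) = 1"
  by (metis star_mult star_star mult_1_left)

lemma norm_star: "norm (star x) = norm (x::'a::cstar_algebra)"
proof -
  have le: "norm y \<le> norm (star y)" for y :: 'a
  proof (cases "norm y = 0")
    case False
    have "norm y * norm y \<le> norm (star y) * norm y"
      using cstar_identity[of y] norm_mult_ineq[of "star y" y] by (simp add: power2_eq_square)
    then show ?thesis using False by simp
  qed simp
  show ?thesis using le[of x] le[of "star x"] by (simp add: star_star)
qed

text \<open>If \<open>s = (c + s\<^sup>2) / 2\<close>, then \<open>1 - s\<close> is a square root of \<open>1 - c\<close>; self-adjointness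
  follows from the uniqueness of the fixed point.\<close>

lemma selfadjoint_sqrt_one_minus:
  fixes c :: "'a::unital_cstar_algebra"
  assumes c: "norm c < 1" "star c = c"
  shows "\<exists>t. star t = t \<and> t * t = 1 - c"
proof -
  define r where "r = norm c"
  define f where "f s = (1/2) *\<^sub>R (c + s * s)" for s :: 'a
  have r: "0 \<le> r" "r < 1" "norm c = r" using c by (auto simp: r_def)
  have "\<exists>!s\<in>cball 0 r. f s = s"
  proof (rule Banach_fix)
    show "complete (cball (0::'a) r)" by (simp add: complete_eq_closed)
    show "cball (0::'a) r \<noteq> {}" "0 \<le> r" "r < 1" using r by auto
    show "f ` cball 0 r \<subseteq> cball 0 r"
    proof safe
      fix s :: 'a assume "s \<in> cball 0 r"
      then have s: "norm s \<le> r" by simp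
      have "norm (s * s) \<le> r * r"
        using order_trans[OF norm_mult_ineq mult_mono[OF s s]] r by simp
      also have "\<dots> \<le> r" using r by (simp add: mult_left_le)
      finally have "norm (c + s * s) \<le> 2 * r"
        using norm_triangle_ineq[of c "s * s"] r by simp
      then show "f s \<in> cball 0 r" by (simp add: f_def)
    qed
    fix s t :: 'a assume "s \<in> cball 0 r" "t \<in> cball 0 r"
    then have s: "norm s \<le> r" and t: "norm t \<le> r" by simp_all
    have "f s - f t = (1/2) *\<^sub>R (s * (s - t) + (s - t) * t)"
      by (simp add: f_def algebra_simps)
    moreover have "norm (s * (s - t)) \<le> r * norm (s - t)"
      using order_trans[OF norm_mult_ineq mult_right_mono[OF s]] by simp
    moreover have "norm ((s - t) * t) \<le> r * norm (s - t)"
      using order_trans[OF norm_mult_ineq mult_left_mono[OF t]] by (simp add: mult.commute)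
    ultimately show "dist (f s) (f t) \<le> r * dist s t"
      using norm_triangle_ineq[of "s * (s - t)" "(s - t) * t"] by (simp add: dist_norm)
  qed
  then obtain s where s: "norm s \<le> r" "f s = s"
    and uniq: "\<And>t. norm t \<le> r \<Longrightarrow> f t = t \<Longrightarrow> t = s"
    by (metis mem_cball_0)
  have "f (star s) = star (f s)"
    by (simp add: f_def star_scaleR star_add star_mult c)
  then have "star s = s" using uniq[of "star s"] s by (simp add: norm_star)
  moreover have "(1 - s) * (1 - s) = 1 - c"
  proof -
    have "c + s * s = s + s"
      using arg_cong[OF s(2), of "\<lambda>x. 2 *\<^sub>R x"] by (simp add: f_def scaleR_2)
    then have "c = s + s - s * s" by (rule eq_diff_eq[THEN iffD2])
    then show ?thesis by (simp only:) (simp add: left_diff_distrib right_diff_distrib)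
  qed
  ultimately show ?thesis by (intro exI[of _ "1 - s"]) (simp add: star_diff star_one)
qed

lemma sum_root_of_unity_powi:
  assumes M: "0 < M" and n: "\<bar>n\<bar> < int M"
  shows "(\<Sum>k<M. cis (2 * pi * real k / real M) powi n) = (if n = 0 then of_nat M else 0)"
proof (cases "n = 0")
  case False
  define w where "w = cis (2 * pi * real_of_int n / real M)"
  have "cis (2 * pi * real k / real M) powi n = w ^ k" for k
    by (simp add: w_def cis_power_int Complex.DeMoivre mult_ac)
  moreover have "w ^ M = 1"
    using M by (simp add: w_def Complex.DeMoivre cis_multiple_2pi)
  moreover have "w \<noteq> 1"
  proof
    assume "w = 1"
    then have "cos (2 * pi * real_of_int n / real M) = 1"
      by (metis w_def cis.sel(1) one_complex.sel(1))
    then obtain j :: int where "2 * pi * real_of_int n / real M = real_of_int j * 2 * pi"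
      by (auto simp: cos_one_2pi_int)
    then have "real_of_int n = real_of_int (j * int M)" using M by (simp add: field_simps)
    then have "int M dvd n" by (metis dvd_triv_right of_int_eq_iff)
    then show False using n False dvd_imp_le_int[of n "int M"] by simp
  qed
  ultimately show ?thesis using False by (simp add: geometric_sum)
qed simp

text \<open>The infima need not be attained and may be 0, so the product bound is proved for
  strictly larger factors, which then decrease to \<open>A\<close> and \<open>B\<close>.\<close>

lemma le_mult_dense:
  fixes A B D :: real
  assumes "\<And>s t. A < s \<Longrightarrow> B < t \<Longrightarrow> D \<le> s * t"
  shows "D \<le> A * B"
proof (rule tendsto_lowerbound)
  show "((\<lambda>e. (A + e) * (B + e)) \<longlongrightarrow> A * B) (at_right 0)"
    by (auto intro!: tendsto_eq_intros)
  show "\<forall>\<^sub>F e in at_right 0. D \<le> (A + e) * (B + e)"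
    by (auto intro!: assms eventually_at_rightI[of 0 1])
qed simp

lemma bop_apply_minus: "bop_apply (S - T) x = bop_apply S x - bop_apply T x"
  by (metis add_diff_cancel_right' bop_apply_plus diff_add_cancel)

lemma bop_apply_sum: "bop_apply (sum f I) x = (\<Sum>i\<in>I. bop_apply (f i) x)"
  by (induction I rule: infinite_finite_induct)
    (simp_all add: bop_apply_plus bop_apply_minus[of 0 0, simplified])

lemma cinner_sum_left: "cinner (sum f I) y = (\<Sum>i\<in>I. cinner (f i) (y::'h::complex_inner))"
  by (induction I rule: infinite_finite_induct) (simp_all add: cinner_zero_left cinner_add_left)

lemma Re_cinner_commute: "Re (cinner y x) = Re (cinner x (y::'h::complex_inner))"
  using cinner_commute[of x y] by simp

section \<open>Partial geometric sums of an off-diagonal matrix\<close>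

primrec alt_prod :: "'a::monoid_mult \<Rightarrow> 'a \<Rightarrow> nat \<Rightarrow> 'a" where
  "alt_prod a b 0 = 1"
| "alt_prod a b (Suc l) = a * alt_prod b a l"

text \<open>The first row of the \<open>l\<close>-th power of the matrix \<open>N\<close> with rows \<open>(0, a)\<close> and \<open>(b, 0)\<close> is
  \<open>(off_power True a b l, off_power False a b l)\<close>; swapping \<open>a\<close> and \<open>b\<close> gives the reversed second row.\<close>

definition off_power :: "bool \<Rightarrow> 'a::unital_cstar_algebra \<Rightarrow> 'a \<Rightarrow> nat \<Rightarrow> 'a" where
  "off_power e a b l = (if even l = e then alt_prod a b l else 0)"

definition off_gsum :: "bool \<Rightarrow> 'a::unital_cstar_algebra \<Rightarrow> 'a \<Rightarrow> complex \<Rightarrow> nat \<Rightarrow> 'a" where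
  "off_gsum e a b z i = (\<Sum>l\<le>i. z ^ l *\<^sub>C off_power e a b l)"

lemma scaleC_sum_right: "c *\<^sub>C sum f I = (\<Sum>i\<in>I. c *\<^sub>C (f i :: 'a::complex_normed_vector))"
  by (induction I rule: infinite_finite_induct)
    (simp_all add: scaleC_add_right scaleC_diff_right[of _ 0 0, simplified])

lemma off_gsum_0: "off_gsum e a b z 0 = (if e then 1 else 0)"
  by (simp add: off_gsum_def off_power_def scaleC_one)

text \<open>The row \<open>(0, a)\<close> of \<open>N\<close> picks out the second row of the
  preceding sum, whence the swap of \<open>a\<close> and \<open>b\<close> and the negated
  flag.\<close>

lemma off_gsum_Suc:
  "off_gsum e a b z (Suc i) = (if e then 1 else 0) + (z *\<^sub>C a) * off_gsum (\<not> e) b a z i"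
proof -
  have "off_power e a b (Suc l) = a * off_power (\<not> e) b a l" for l
    by (auto simp: off_power_def)
  then show ?thesis
    unfolding off_gsum_def
    by (subst sum.atMost_Suc_shift)
      (auto simp: off_power_def scaleC_one mult_scaleC_left mult_scaleC_right sum_distrib_left
        scaleC_sum_right scaleC_scaleC mult.commute)
qed

section \<open>Quadratic forms of a 2-positive map\<close>

locale unital_two_positive =
  fixes \<phi> :: "'a::unital_cstar_algebra \<Rightarrow> 'h::chilbert_space bop"
  assumes clinear: "clinear \<phi>" and unital: "\<phi> 1 = 1" and two_positive: "n_positive 2 \<phi>"
begin

lemma phi_add: "\<phi> (x + y) = \<phi> x + \<phi> y"
  and phi_scaleC: "\<phi> (c *\<^sub>C x) = c *\<^sub>C \<phi> x"
  using clinear by (auto simp: clinear_def)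

lemma phi_zero: "\<phi> 0 = 0"
  using phi_add[of 0 0] by simp

lemma phi_diff: "\<phi> (x - y) = \<phi> x - \<phi> y"
  using phi_add[of "x - y" y] by simp

lemma phi_sum: "\<phi> (sum f I) = (\<Sum>i\<in>I. \<phi> (f i))"
  by (induction I rule: infinite_finite_induct) (simp_all add: phi_zero phi_add)

text \<open>The Gram matrix of \<open>x\<close>, \<open>y\<close> is positive, so its image is
  \<open>star_mat Y * Y\<close>; the columns of \<open>Y\<close> are \<open>(p, r)\<close> and
  \<open>(q, s)\<close>.\<close>

lemma phi_gram:
  obtains p q r s where
    "\<phi> (star x * x) = star p * p + star r * r" "\<phi> (star x * y) = star p * q + star r * s"
    "\<phi> (star y * x) = star q * p + star s * r" "\<phi> (star y * y) = star q * q + star s * s"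
proof -
  define X where "X = mat 2 2 (\<lambda>(i, j). if i = 0 then if j = 0 then x else y else 0)"
  have X: "X \<in> carrier_mat 2 2" by (simp add: X_def)
  have gram: "(star_mat Z * Z) $$ (i, j) = star (Z $$ (0, i)) * Z $$ (0, j)
      + star (Z $$ (1, i)) * Z $$ (1, j)"
    if "Z \<in> carrier_mat 2 2" "i < 2" "j < 2" for Z :: "'c::cstar_algebra mat" and i j
    using that by (simp add: star_mat_def scalar_prod_def numeral_2_eq_2)
  have "positive_mat 2 (star_mat X * X)"
    using X by (auto simp: positive_mat_def)
  moreover have "star_mat X * X \<in> carrier_mat 2 2"
    using X by (auto simp: star_mat_def)
  ultimately obtain Y where Y: "Y \<in> carrier_mat 2 2"
    and eq: "map_mat \<phi> (star_mat X * X) = star_mat Y * Y"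
    using two_positive by (auto simp: n_positive_def positive_mat_def)
  have *: "\<phi> ((star_mat X * X) $$ (i, j)) = (star_mat Y * Y) $$ (i, j)" if "i < 2" "j < 2" for i j
    using that X Y by (subst eq[symmetric]) (auto simp: star_mat_def)
  \<comment> \<open>\<open>of\<close> takes the variables in order of occurrence: \<open>p\<close>,
    \<open>r\<close>, \<open>q\<close>, \<open>s\<close>.\<close>
  show ?thesis
    by (rule that[of "Y $$ (0, 0)" "Y $$ (1, 0)" "Y $$ (0, 1)" "Y $$ (1, 1)"])
      (use *[of 0 0] *[of 0 1] *[of 1 0] *[of 1 1] gram[OF X] gram[OF Y] in
        \<open>simp_all add: X_def star_zero\<close>)
qed

lemma phi_star: "\<phi> (star x) = star (\<phi> x)"
  by (rule phi_gram[of 1 x]) (simp add: star_one star_add star_mult star_star)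

text \<open>\<open>Q h k x y\<close> is \<open>\<langle>\<phi>\<^sub>2 (R\<^sup>* R) (h, k), (h, k)\<rangle>\<close> for the row \<open>R = (x, y)\<close>.\<close>

definition Q :: "'h \<Rightarrow> 'h \<Rightarrow> 'a \<Rightarrow> 'a \<Rightarrow> real" where
  "Q h k x y = Re (cinner (bop_apply (\<phi> (star x * x)) h) h + cinner (bop_apply (\<phi> (star x * y)) k) h
    + cinner (bop_apply (\<phi> (star y * x)) h) k + cinner (bop_apply (\<phi> (star y * y)) k) k)"

lemma Q_nonneg: "0 \<le> Q h k x y"
proof (rule phi_gram[of x y])
  fix p q r s
  assume *: "\<phi> (star x * x) = star p * p + star r * r" "\<phi> (star x * y) = star p * q + star r * s"
    "\<phi> (star y * x) = star q * p + star s * r" "\<phi> (star y * y) = star q * q + star s * s"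
  let ?u = "bop_apply p h + bop_apply q k" and ?v = "bop_apply r h + bop_apply s k"
  have "Q h k x y = Re (cinner ?u ?u + cinner ?v ?v)"
    unfolding Q_def *
    by (simp add: bop_apply_plus bop_apply_times cinner_add_left cinner_add_right cinner_star')
  then show ?thesis by (simp add: cinner_self)
qed

text \<open>For a self-adjoint square root \<open>t\<close> of \<open>1 - star a * a\<close>, the
  two sides differ by \<open>Q h k (t * x) (t * y)\<close>.\<close>

lemma Q_contraction:
  assumes "norm a < 1"
  shows "Q h k (a * x) (a * y) \<le> Q h k x y"
proof -
  have "norm (star a * a) < 1" "star (star a * a) = star a * a"
    using assms by (simp_all add: cstar_identity star_mult star_star power_less_one_iff)
  then obtain t where t: "star t = t" "t * t = 1 - star a * a"
    using selfadjoint_sqrt_one_minus by blast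
  have "star (t * u) * (t * v) = star u * (t * t) * v" for u v
    using t(1) by (simp add: star_mult mult.assoc)
  then have "star (t * u) * (t * v) = star u * v - star (a * u) * (a * v)" for u v
    unfolding t(2) by (simp add: star_mult algebra_simps)
  then have "Q h k (t * x) (t * y) = Q h k x y - Q h k (a * x) (a * y)"
    unfolding Q_def by (simp add: phi_diff bop_apply_minus cinner_diff_left)
  then show ?thesis using Q_nonneg[of h k "t * x" "t * y"] by simp
qed

text \<open>This rests on \<open>star (1 + x) * (1 + x) = star x * x + (1 + x) + star (1 + x) -
  1\<close>; keeping \<open>1 + x\<close> intact makes the linear term a partial sum again.\<close>

lemma Q_one_plus_left:
  "Q h k (1 + x) y = Q h k x y
    + 2 * Re (cinner (bop_apply (\<phi> (1 + x)) h) h + cinner (bop_apply (\<phi> y) k) h) - (norm h)\<^sup>2"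
  unfolding Q_def
  by (simp add: distrib_left distrib_right star_add star_one phi_add phi_star unital bop_apply_plus
      bop_apply_one cinner_add_left cinner_star' cinner_self Re_cinner_commute[of h])

lemma Q_one_plus_right:
  "Q h k x (1 + y) = Q h k x y
    + 2 * Re (cinner (bop_apply (\<phi> x) h) k + cinner (bop_apply (\<phi> (1 + y)) k) k) - (norm k)\<^sup>2"
  unfolding Q_def
  by (simp add: distrib_left distrib_right star_add star_one phi_add phi_star unital bop_apply_plus
      bop_apply_one cinner_add_left cinner_star' cinner_self Re_cinner_commute[of k])

text \<open>\<open>pairing p q r s h k\<close> is \<open>\<langle>\<phi>\<^sub>2 X (h, k), (h, k)\<rangle>\<close> for the matrix \<open>X\<close> with rows
  \<open>(p, q)\<close> and \<open>(r, s)\<close>.\<close>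

definition pairing :: "'a \<Rightarrow> 'a \<Rightarrow> 'a \<Rightarrow> 'a \<Rightarrow> 'h \<Rightarrow> 'h \<Rightarrow> complex" where
  "pairing p q r s h k = cinner (bop_apply (\<phi> p) h) h + cinner (bop_apply (\<phi> q) k) h
    + cinner (bop_apply (\<phi> r) h) k + cinner (bop_apply (\<phi> s) k) k"

abbreviation power_pairing :: "'a \<Rightarrow> 'a \<Rightarrow> nat \<Rightarrow> 'h \<Rightarrow> 'h \<Rightarrow> complex" where
  "power_pairing a b l \<equiv> pairing (off_power True a b l) (off_power False a b l)
    (off_power False b a l) (off_power True b a l)"

lemma pairing_off_gsum:
  "pairing (off_gsum True a b z i) (off_gsum False a b z i) (off_gsum False b a z i)
    (off_gsum True b a z i) h k = (\<Sum>l\<le>i. z ^ l * power_pairing a b l h k)"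
  by (simp add: pairing_def off_gsum_def phi_sum phi_scaleC bop_apply_sum bop_apply_scaleC_left
      cinner_sum_left cinner_scaleC_left sum.distrib distrib_left)

lemma power_pairing_0: "power_pairing a b 0 h k = complex_of_real ((norm h)\<^sup>2 + (norm k)\<^sup>2)"
  by (simp add: pairing_def off_power_def phi_zero unital bop_apply_one cinner_self
      bop_apply_minus[of 0 0, simplified] cinner_zero_left)

text \<open>Let \<open>Y i\<close> be the \<open>i\<close>-th partial sum of the geometric series of \<open>z N\<close>.  The recurrence
  \<open>Y (i + 1) = 1 + z N Y i\<close> gives
  \<open>Y (i + 1) + (Y (i + 1))\<^sup>* - 1 = (Y (i + 1))\<^sup>* Y (i + 1) - (z N Y i)\<^sup>* (z N Y i)\<close>; since \<open>z N\<close> is a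
  contraction, the sum of these over \<open>i\<close> is bounded below by the telescoping sum of
  \<open>(Y (i + 1))\<^sup>* Y (i + 1) - (Y i)\<^sup>* Y i\<close>.\<close>

lemma sum_power_pairing_nonneg:
  assumes z: "cmod z = 1" and a: "norm a < 1" and b: "norm b < 1"
  shows "0 \<le> (\<Sum>i\<le>m. 2 * Re (\<Sum>l\<le>i. z ^ l * power_pairing a b l h k)
    - Re (power_pairing a b 0 h k))"
proof -
  define T where "T i = Q h k (off_gsum True a b z i) (off_gsum False a b z i)
    + Q h k (off_gsum False b a z i) (off_gsum True b a z i)" for i
  define R where "R i = 2 * Re (\<Sum>l\<le>i. z ^ l * power_pairing a b l h k)
    - Re (power_pairing a b 0 h k)" for i
  have "T m \<le> (\<Sum>i\<le>m. R i)"
  proof (induction m)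
    case 0
    show ?case
      unfolding R_def power_pairing_0
      by (simp add: T_def off_gsum_0 power_pairing_0 Q_def star_zero star_one phi_zero unital bop_apply_one
        bop_apply_minus[of 0 0, simplified] cinner_zero_left cinner_self)
  next
    case (Suc i)
    let ?za = "z *\<^sub>C a" and ?zb = "z *\<^sub>C b"
    let ?p = "off_gsum True a b z" and ?q = "off_gsum False a b z"
      and ?r = "off_gsum False b a z" and ?s = "off_gsum True b a z"
    have n: "norm ?za < 1" "norm ?zb < 1" using z a b by (simp_all add: norm_scaleC)
    have eqs: "?p (Suc i) = 1 + ?za * ?r i" "?q (Suc i) = ?za * ?s i"
      "?r (Suc i) = ?zb * ?p i" "?s (Suc i) = 1 + ?zb * ?q i"
      by (simp_all add: off_gsum_Suc)
    have "T (Suc i) = Q h k (?za * ?r i) (?za * ?s i) + Q h k (?zb * ?p i) (?zb * ?q i) + R (Suc i)"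
      unfolding R_def power_pairing_0 pairing_off_gsum[symmetric]
      unfolding T_def eqs Q_one_plus_left Q_one_plus_right pairing_def by simp
    also have "\<dots> \<le> Q h k (?r i) (?s i) + Q h k (?p i) (?q i) + R (Suc i)"
      by (intro add_mono Q_contraction n order_refl)
    also have "\<dots> = T i + R (Suc i)" by (simp add: T_def)
    finally show ?case using Suc by simp
  qed
  moreover have "0 \<le> T m" by (simp add: T_def Q_nonneg)
  ultimately show ?thesis by (simp add: R_def)
qed

section \<open>Averaging over roots of unity\<close>

text \<open>The twists sort the terms by powers of \<open>z\<close>. Exponent 0, which alone
  survives averaging, occurs only for \<open>l = 0\<close> (norms), \<open>l = 1\<close>
  (\<open>a\<close> and \<open>b\<close>) and \<open>l = 2\<close> (\<open>a * b\<close>).\<close>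

lemma power_pairing_rotate:
  assumes z: "cmod z = 1"
  shows "z ^ l * power_pairing a b l (h + z powi (-2) *\<^sub>C k) (z powi (-1) *\<^sub>C g) =
      z powi (int l) * (cinner (bop_apply (\<phi> (off_power True a b l)) h) h
        + cinner (bop_apply (\<phi> (off_power True a b l)) k) k
        + cinner (bop_apply (\<phi> (off_power True b a l)) g) g)
    + z powi (int l - 1) * (cinner (bop_apply (\<phi> (off_power False a b l)) g) h
        + cinner (bop_apply (\<phi> (off_power False b a l)) k) g)
    + z powi (int l - 2) * cinner (bop_apply (\<phi> (off_power True a b l)) k) h
    + z powi (int l + 1) * (cinner (bop_apply (\<phi> (off_power False a b l)) g) k
        + cinner (bop_apply (\<phi> (off_power False b a l)) h) g)
    + z powi (int l + 2) * cinner (bop_apply (\<phi> (off_power True a b l)) h) k"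
proof -
  have z0: "z \<noteq> 0" using z by auto
  have "z * cnj z = 1" using z by (simp add: complex_norm_square[symmetric])
  then have inv: "inverse z = cnj z" by (rule inverse_unique)
  have w: "z powi (-1) = cnj z" "z powi (-2) = cnj z * cnj z"
    using inv by (simp_all add: power_int_minus power2_eq_square power_int_def)
  have e: "z powi (int l - 1) = z ^ l * cnj z" "z powi (int l - 2) = z ^ l * (cnj z * cnj z)"
    "z powi (int l + 1) = z ^ l * z" "z powi (int l + 2) = z ^ l * (z * z)"
    using z0 inv by (simp_all add: power_int_diff power_int_add power2_eq_square divide_inverse)
  have ring: "t * (A + u * (u * B) + w * (w * (C + u * (u * D))) + (w * (F + u * (u * G)))
      + (u * (P + w * (w * R))) + u * (w * S))
    = t * (A + D + S) + t * w * (F + R) + t * (w * w) * C + t * u * (G + P) + t * (u * u) * B"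
    if "u * w = 1" for t u w A B C D F G P R S :: complex
  proof -
    have c: "u * (w * x) = x" "w * (u * x) = x" for x
      using that by (simp_all add: mult.assoc[symmetric] mult.commute)
    show ?thesis by (simp add: distrib_left distrib_right mult.assoc c add_ac)
  qed
  show ?thesis
    unfolding pairing_def w e power_int_of_nat
    by (subst ring[OF \<open>z * cnj z = 1\<close>, symmetric])
      (simp add: bop_apply_add bop_apply_scaleC cinner_add_left cinner_add_right
        cinner_scaleC_left cinner_scaleC_right distrib_left distrib_right mult.assoc)
qed

text \<open>Positivity of the Toeplitz form of \<open>1, \<phi>\<^sub>2 N, \<phi>\<^sub>2 (N\<^sup>2)\<close> on \<open>(h, 0), (0, g), (k, 0)\<close>: averaging the
  rotated inequalities over the \<open>M\<close>-th roots of unity isolates the diagonal terms with the Fejer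
  weights, and \<open>n \<rightarrow> \<infinity>\<close> removes the weights.\<close>

lemma three_vector_positivity:
  assumes a: "norm a < 1" and b: "norm b < 1"
  shows "0 \<le> (norm h)\<^sup>2 + (norm g)\<^sup>2 + (norm k)\<^sup>2 + 2 * Re (cinner (bop_apply (\<phi> a) g) h
    + cinner (bop_apply (\<phi> b) k) g + cinner (bop_apply (\<phi> (a * b)) k) h)"
proof -
  define R0 where "R0 = (norm h)\<^sup>2 + (norm g)\<^sup>2 + (norm k)\<^sup>2"
  define E1 where "E1 = cinner (bop_apply (\<phi> a) g) h + cinner (bop_apply (\<phi> b) k) g"
  define E2 where "E2 = cinner (bop_apply (\<phi> (a * b)) k) h"
  define C where "C l = (if l = 0 then of_real R0 else if l = 1 then E1 else if l = 2 then E2 else 0)"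
    for l :: nat
  have bound: "0 \<le> real (n + 2) * R0 + 2 * real (n + 1) * Re E1 + 2 * real n * Re E2" for n
  proof -
    \<comment> \<open>For \<open>l \<le> Suc n\<close> the exponents \<open>l - 2\<close> to
      \<open>l + 2\<close> lie between -2 and \<open>n + 3\<close>, so only 0 is divisible by
      \<open>M\<close>.\<close>
    define M where "M = n + 4"
    define z where "z j = cis (2 * pi * real j / real M)" for j :: nat
    define F where "F j l = power_pairing a b l (h + z j powi (-2) *\<^sub>C k) (z j powi (-1) *\<^sub>C g)" for j l
    have z1: "cmod (z j) = 1" for j by (simp add: z_def)
    have powi: "(\<Sum>j<M. z j powi i * x) = (if i = 0 then of_nat M * x else 0)"
      if "\<bar>i\<bar> < int M" for i x
      using sum_root_of_unity_powi[OF _ that]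
      by (simp add: z_def sum_distrib_right[symmetric] M_def)
    have avg: "(\<Sum>j<M. z j ^ l * F j l) = of_nat M * C l" if l: "l \<le> Suc n" for l
    proof -
      have op: "off_power True a b 0 = 1" "off_power True b a 0 = 1"
        "off_power False a b 1 = a" "off_power False b a 1 = b" "off_power True a b 2 = a * b"
        by (simp_all add: off_power_def numeral_2_eq_2)
      show ?thesis
        unfolding F_def power_pairing_rotate[OF z1] sum.distrib
        using l
        by (subst powi, simp add: M_def)+
          (auto simp: C_def R0_def E1_def E2_def op[unfolded One_nat_def] unital bop_apply_one cinner_self)
    qed
    have avg_diff: "(\<Sum>j<M. 2 * Re (\<Sum>l\<le>i. z j ^ l * F j l) - Re (F j 0))
        = real M * (2 * Re (\<Sum>l\<le>i. C l) - R0)" if i: "i \<le> Suc n" for i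
    proof -
      have "(\<Sum>j<M. \<Sum>l\<le>i. z j ^ l * F j l) = (\<Sum>l\<le>i. \<Sum>j<M. z j ^ l * F j l)"
        by (rule sum.swap)
      also have "\<dots> = (\<Sum>l\<le>i. of_nat M * C l)"
        using i by (intro sum.cong avg) auto
      finally have 1: "Re (\<Sum>j<M. \<Sum>l\<le>i. z j ^ l * F j l) = real M * Re (\<Sum>l\<le>i. C l)"
        by (simp add: sum_distrib_left)
      have 2: "Re (\<Sum>j<M. F j 0) = real M * R0"
        using arg_cong[OF avg[of 0], of Re] by (simp add: C_def)
      show ?thesis
        by (simp only: sum_subtractf sum_distrib_left[symmetric] Re_sum[symmetric] 1 2)
          (simp only: right_diff_distrib mult.left_commute)
    qed
    have "0 \<le> (\<Sum>j<M. \<Sum>i\<le>Suc n. 2 * Re (\<Sum>l\<le>i. z j ^ l * F j l) - Re (F j 0))"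
      unfolding F_def by (rule sum_nonneg) (rule sum_power_pairing_nonneg[OF z1 a b])
    also have "\<dots> = (\<Sum>i\<le>Suc n. \<Sum>j<M. 2 * Re (\<Sum>l\<le>i. z j ^ l * F j l) - Re (F j 0))"
      by (rule sum.swap)
    also have "\<dots> = (\<Sum>i\<le>Suc n. real M * (2 * Re (\<Sum>l\<le>i. C l) - R0))"
      by (intro sum.cong avg_diff) auto
    also have "\<dots> = real M * (\<Sum>i\<le>Suc n. 2 * Re (\<Sum>l\<le>i. C l) - R0)"
      by (rule sum_distrib_left[symmetric])
    \<comment> \<open>Of the \<open>n + 2\<close> summands, \<open>E1\<close> enters those with
      \<open>i \<ge> 1\<close> and \<open>E2\<close> those with \<open>i \<ge> 2\<close>.\<close>
    also have "(\<Sum>i\<le>Suc n. 2 * Re (\<Sum>l\<le>i. C l) - R0)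
      = real (n + 2) * R0 + 2 * real (n + 1) * Re E1 + 2 * real n * Re E2"
    proof (induction n)
      case 0
      then show ?case by (simp add: C_def)
    next
      case (Suc n)
      have "(\<Sum>l\<le>Suc (Suc n). C l) = of_real R0 + E1 + E2"
        by (induction n) (simp_all add: C_def numeral_2_eq_2)
      then have "Re (\<Sum>l\<le>Suc (Suc n). C l) = R0 + Re E1 + Re E2"
        by simp
      then show ?case
        unfolding sum.atMost_Suc[of "\<lambda>i. 2 * Re (\<Sum>l\<le>i. C l) - R0" "Suc n"] Suc
        by (simp only:) (simp add: algebra_simps)
    qed
    finally show ?thesis by (simp add: M_def zero_le_mult_iff)
  qed
  have "0 \<le> R0 + 2 * Re E1 + 2 * Re E2"
  proof (rule ccontr)
    assume "\<not> ?thesis"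
    then have "0 < - (R0 + 2 * Re E1 + 2 * Re E2)" by simp
    then obtain n where "2 * R0 + 2 * Re E1 < real n * - (R0 + 2 * Re E1 + 2 * Re E2)"
      using reals_Archimedean3 by blast
    then show False using bound[of n] by (simp add: algebra_simps)
  qed
  then show ?thesis by (simp add: R0_def E1_def E2_def)
qed

section \<open>Norm estimates\<close>

text \<open>Eliminating \<open>g\<close> from the three-vector form, as in a Schur complement,
  leaves a form in \<open>h\<close>, \<open>k\<close> with off-diagonal part
  \<open>D\<close>.\<close>

lemma covariance_le_one:
  assumes a: "norm a < 1" and b: "norm b < 1"
  shows "norm (\<phi> (a * b) - \<phi> a * \<phi> b) \<le> 1"
proof -
  define D where "D = \<phi> (a * b) - \<phi> a * \<phi> b"
  \<comment> \<open>\<open>g = - (\<phi> b k + (\<phi> a)\<^sup>* h)\<close> minimises the three-vector form.\<close>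
  have quad: "0 \<le> (norm h)\<^sup>2 + (norm k)\<^sup>2 + 2 * Re (cinner (bop_apply D k) h)" for h k
  proof -
    define u where "u = bop_apply (star (\<phi> a)) h"
    define v where "v = bop_apply (\<phi> b) k"
    define g where "g = - (v + u)"
    have 1: "cinner (bop_apply (\<phi> a) g) h = cinner g u" by (simp add: u_def cinner_star)
    have 2: "Re (cinner v g) = Re (cinner g v)" using cinner_commute[of v g] by simp
    have 3: "cinner g u + cinner g v = - cinner g g"
      using cinner_diff_right[of g 0 g] by (simp add: cinner_zero_right cinner_add_right g_def
        cinner_diff_right[of "- (v + u)" 0 "v + u", simplified] flip: cinner_add_right)
    have 4: "cinner (bop_apply D k) h = cinner (bop_apply (\<phi> (a * b)) k) h - cinner v u"
      by (simp add: D_def bop_apply_minus bop_apply_times cinner_diff_left u_def v_def cinner_star)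
    have 5: "(norm g)\<^sup>2 = (norm u)\<^sup>2 + (norm v)\<^sup>2 + 2 * Re (cinner v u)"
      using norm_diff_sq[of v "-1" u]
      by (simp only: g_def norm_minus_cancel) (simp add: scaleC_minus1)
    have "0 \<le> (norm h)\<^sup>2 + (norm g)\<^sup>2 + (norm k)\<^sup>2 + 2 * Re (cinner g u + cinner v g
        + cinner (bop_apply (\<phi> (a * b)) k) h)"
      using three_vector_positivity[OF a b, of h g k] unfolding 1 v_def .
    also have "\<dots> = (norm h)\<^sup>2 + (norm k)\<^sup>2 - (norm g)\<^sup>2 + 2 * Re (cinner (bop_apply (\<phi> (a * b)) k) h)"
      using arg_cong[OF 3, of Re] 2 by (simp add: cinner_self)
    \<comment> \<open>By 5, \<open>(norm g)\<^sup>2\<close> is at least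
      \<open>2 * Re (cinner v u)\<close>, the contribution of
      \<open>\<phi> a * \<phi> b\<close>.\<close>
    finally show ?thesis unfolding 4 using 5 by simp (smt (verit) zero_le_power2)
  qed
  have "norm D \<le> 1"
  proof (rule norm_bop_bound)
    fix k
    let ?y = "bop_apply D k"
    show "norm ?y \<le> 1 * norm k"
    proof (cases "?y = 0")
      case False
      \<comment> \<open>With this scaling the test vector \<open>- c ?y\<close> has the norm of
        \<open>k\<close>.\<close>
      define c where "c = norm k / norm ?y"
      have "0 \<le> (norm (complex_of_real (- c) *\<^sub>C ?y))\<^sup>2 + (norm k)\<^sup>2
        + 2 * Re (cinner ?y (complex_of_real (- c) *\<^sub>C ?y))" by (rule quad)
      also have "\<dots> = (c * norm ?y)\<^sup>2 + (norm k)\<^sup>2 - 2 * (c * norm ?y) * norm ?y"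
        by (simp add: norm_scaleC cinner_scaleC_right cinner_self power_mult_distrib)
          (simp add: power2_eq_square)
      also have "c * norm ?y = norm k" using False by (simp add: c_def)
      finally have "norm k * norm ?y \<le> norm k * norm k" by (simp add: power2_eq_square)
      moreover have "norm k \<noteq> 0" using False linear_0[OF bounded_linear.linear[OF bounded_linear_bop_apply[of D]]]
        by auto
      ultimately show ?thesis by simp
    qed simp
  qed simp
  then show ?thesis by (simp add: D_def)
qed

lemma phi_scaleR: "\<phi> (r *\<^sub>R x) = r *\<^sub>R \<phi> x"
  by (simp add: scaleR_scaleC phi_scaleC)

lemma covariance_le:
  assumes a: "norm a < s" and b: "norm b < t"
  shows "norm (\<phi> (a * b) - \<phi> a * \<phi> b) \<le> s * t"
proof -
  have st: "0 < s" "0 < t" using a b norm_ge_zero[of a] norm_ge_zero[of b] by linarith+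
  have "norm ((1/s) *\<^sub>R a) < 1" "norm ((1/t) *\<^sub>R b) < 1" using a b st by simp_all
  from covariance_le_one[OF this]
  have "norm ((1 / (s * t)) *\<^sub>R (\<phi> (a * b) - \<phi> a * \<phi> b)) \<le> 1"
    by (simp add: phi_scaleR scaleR_right_diff_distrib mult.commute)
  then have "norm (\<phi> (a * b) - \<phi> a * \<phi> b) / (s * t) \<le> 1"
    using st by (simp only: norm_scaleR) simp
  then show ?thesis using st by (simp add: pos_divide_le_eq)
qed

text \<open>As \<open>\<phi>\<close> fixes scalars, the cross terms cancel; norms may thus be
  replaced by distances to the scalars.\<close>

lemma covariance_shift:
  "\<phi> ((a - l *\<^sub>C 1) * (b - m *\<^sub>C 1)) - \<phi> (a - l *\<^sub>C 1) * \<phi> (b - m *\<^sub>C 1)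
    = \<phi> (a * b) - \<phi> a * \<phi> b"
  by (simp add: algebra_simps phi_diff phi_add phi_scaleC unital mult_scaleC_left mult_scaleC_right)

end

theorem theorem2:
  fixes \<phi> :: "'a::unital_cstar_algebra \<Rightarrow> 'h::chilbert_space bop"
  assumes "clinear \<phi>"
    and "\<phi> 1 = 1"
    and "n_positive 2 \<phi>"
  shows "\<forall>a b. norm (\<phi> (a * b) - \<phi> a * \<phi> b)
    \<le> (INF l. norm (a - l *\<^sub>C 1)) * (INF m. norm (b - m *\<^sub>C 1))"
proof (intro allI)
  interpret unital_two_positive \<phi> using assms by unfold_locales
  have inf: "\<exists>l. norm (c - l *\<^sub>C 1) < s" if "(INF l. norm (c - l *\<^sub>C 1)) < s" for c :: 'a and s
    using that by (subst (asm) cINF_less_iff) (auto intro!: bdd_belowI2[of _ 0])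
  fix a b
  show "norm (\<phi> (a * b) - \<phi> a * \<phi> b)
    \<le> (INF l. norm (a - l *\<^sub>C 1)) * (INF m. norm (b - m *\<^sub>C 1))"
  proof (rule le_mult_dense)
    fix s t
    assume s: "(INF l. norm (a - l *\<^sub>C 1)) < s" and t: "(INF m. norm (b - m *\<^sub>C 1)) < t"
    obtain l m where "norm (a - l *\<^sub>C 1) < s" "norm (b - m *\<^sub>C 1) < t"
      using inf[OF s] inf[OF t] by blast
    from covariance_le[OF this] show "norm (\<phi> (a * b) - \<phi> a * \<phi> b) \<le> s * t"
      unfolding covariance_shift .
  qed
qed

end
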